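(* Let $n\ge 1$, $N=2^n$, let $z\in\{0,1\}^n$, let $\mathcal{U}$ be an arbitrary unitary operator on $(\mathbb{C}^2)^{\otimes n}$, and let $|\psi\rangle=\mathcal{U}|0^n\rangle$ and $\delta=|\psi\rangle\langle\psi|$ be the initial state of the generalized Bernstein-Vazirani (GBV) algorithm with secret string $z$. Then the success probability of the algorithm satisfies $$P_{\mathrm{succ}}^{G}(\delta)=C_{\mathcal{F}}(\delta),$$ where $C_{\mathcal{F}}(\delta)=\langle\eta|\delta|\eta\rangle$ is the coherence fraction of $\delta$, i.e. the fidelity between $\delta$ and the maximally coherent state $|\eta\rangle=\frac{1}{\sqrt{N}}\sum_{x=0}^{N-1}|x\rangle$.
   Context: Basis states $|x\rangle$, $0\le x\le N-1$, of $(\mathbb{C}^2)^{\otimes n}$ are identified with bit strings $x\in\{0,1\}^n$ via binary representation; $|0^n\rangle$ is the all-zero basis state. For the secret string $z\in\{0,1\}^n$ let $\ell(x)=z\cdot x \bmod 2$, where $z\cdot x=\sum_{k=1}^n z_kx_k$. The oracle $\mathcal{O}_\ell$ is the unitary on $(\mathbb{C}^2)^{\otimes n}$ with $\mathcal{O}_\ell|x\rangle=(-1)^{\ell(x)}|x\rangle$. $H$ is the single-qubit Hadamard gate, so $H^{\otimes n}|x\rangle=\frac{1}{\sqrt N}\sum_{y=0}^{N-1}(-1)^{x\cdot y}|y\rangle$. GBV algorithm: start from $|0^n\rangle$, apply an arbitrary unitary $\mathcal{U}$ to get the initial state $|\psi\rangle=\mathcal{U}|0^n\rangle$, apply $\mathcal{O}_\ell$,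 apply $H^{\otimes n}$, and measure in the computational basis (the ancilla qubit is omitted since its state is unchanged by the oracle). The algorithm succeeds if the outcome is $z$; its success probability is $$P_{\mathrm{succ}}^{G}(\delta)=\left|\langle z|H^{\otimes n}\mathcal{O}_\ell\,\mathcal{U}|0^n\rangle\right|^2,\qquad \delta=|\psi\rangle\langle\psi|.$$ State coherence fraction: for a density operator $\rho$ on $(\mathbb{C}^2)^{\otimes n}$, $C_{\mathcal F}(\rho):=\langle\eta|\rho|\eta\rangle$, which is the Uhlmann fidelity between $\rho$ and $|\eta\rangle$. *)

theory Defs
  imports "Jordan_Normal_Form.Schur_Decomposition"
begin

text \<open>
  The space of \<open>n\<close> qubits is \<open>\<complex>\<^bsup>N\<^esup>\<close> with \<open>N = 2 ^ n\<close>, in computational-basis coordinates.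
  A bit string of length \<open>n\<close> is the number \<open>x < 2 ^ n\<close> that it represents in binary, and operators
  are \<open>N \<times> N\<close> matrices.
\<close>

definition ket :: "nat \<Rightarrow> nat \<Rightarrow> complex vec" where
  "ket n x = unit_vec (2 ^ n) x"

text \<open>The inner product of the library is conjugate linear in its second argument.\<close>

definition braket :: "complex vec \<Rightarrow> complex vec \<Rightarrow> complex" where
  "braket v w = w \<bullet>c v"

definition ketbra :: "complex vec \<Rightarrow> complex vec \<Rightarrow> complex mat" where
  "ketbra v w = mat (dim_vec v) (dim_vec w) (\<lambda>(i, j). v $ i * cnj (w $ j))"

definition unitary :: "complex mat \<Rightarrow> bool" where
  "unitary U \<longleftrightarrow> square_mat U \<and>
     mat_adjoint U * U = 1\<^sub>m (dim_row U) \<and> U * mat_adjoint U = 1\<^sub>m (dim_row U)"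

text \<open>
  Bit \<open>k\<close>, for \<open>1 \<le> k \<le> n\<close>, of the string \<open>x\<^sub>1 \<dots> x\<^sub>n\<close>. Bit 1 is the most significant one, which agrees
  with the ordering of tensor factors in \<open>kron\<close> below.
\<close>

definition string_bit :: "nat \<Rightarrow> nat \<Rightarrow> nat \<Rightarrow> nat" where
  "string_bit n x k = of_bool (bit x (n - k))"

definition string_dot :: "nat \<Rightarrow> nat \<Rightarrow> nat \<Rightarrow> nat" where
  "string_dot n x y = (\<Sum>k = 1..n. string_bit n x k * string_bit n y k)"

definition bv_function :: "nat \<Rightarrow> nat \<Rightarrow> nat \<Rightarrow> nat" where
  "bv_function n z x = string_dot n z x mod 2"

definition phase_oracle :: "nat \<Rightarrow> (nat \<Rightarrow> nat) \<Rightarrow> complex mat" where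
  "phase_oracle n l = mat (2 ^ n) (2 ^ n) (\<lambda>(x, y). if x = y then (- 1) ^ l x else 0)"

lemma phase_oracle_ket:
  assumes "x < 2 ^ n"
  shows "phase_oracle n l *\<^sub>v ket n x = (- 1) ^ l x \<cdot>\<^sub>v ket n x"
proof (rule eq_vecI)
  fix i assume "i < dim_vec ((- 1) ^ l x \<cdot>\<^sub>v ket n x)"
  then have i: "i < 2 ^ n" by (simp add: ket_def)
  have "(phase_oracle n l *\<^sub>v ket n x) $ i = row (phase_oracle n l) i $ x"
    using i assms by (simp add: phase_oracle_def ket_def)
  then show "(phase_oracle n l *\<^sub>v ket n x) $ i = ((- 1) ^ l x \<cdot>\<^sub>v ket n x) $ i"
    using i assms by (simp add: phase_oracle_def ket_def)
qed (simp add: phase_oracle_def ket_def)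

definition kron :: "complex mat \<Rightarrow> complex mat \<Rightarrow> complex mat" where
  "kron A B = mat (dim_row A * dim_row B) (dim_col A * dim_col B)
     (\<lambda>(i, j). A $$ (i div dim_row B, j div dim_col B) * B $$ (i mod dim_row B, j mod dim_col B))"

primrec kron_power :: "complex mat \<Rightarrow> nat \<Rightarrow> complex mat" where
  "kron_power A 0 = 1\<^sub>m 1"
| "kron_power A (Suc n) = kron A (kron_power A n)"

definition hadamard :: "complex mat" where
  "hadamard = complex_of_real (1 / sqrt 2) \<cdot>\<^sub>m mat_of_rows_list 2 [[1, 1], [1, - 1]]"

definition gbv_initial_state :: "nat \<Rightarrow> complex mat \<Rightarrow> complex vec" where
  "gbv_initial_state n U = U *\<^sub>v ket n 0"

definition gbv_final_state :: "nat \<Rightarrow> nat \<Rightarrow> complex mat \<Rightarrow> complex vec" where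
  "gbv_final_state n z U =
     kron_power hadamard n *\<^sub>v (phase_oracle n (bv_function n z) *\<^sub>v gbv_initial_state n U)"

definition gbv_success_prob :: "nat \<Rightarrow> nat \<Rightarrow> complex mat \<Rightarrow> real" where
  "gbv_success_prob n z U = (cmod (braket (ket n z) (gbv_final_state n z U)))\<^sup>2"

definition max_coherent :: "nat \<Rightarrow> complex vec" where
  "max_coherent n =
     complex_of_real (1 / sqrt (2 ^ n)) \<cdot>\<^sub>v finsum_vec TYPE(complex) (2 ^ n) (ket n) {0..<2 ^ n}"

text \<open>
  Kept complex-valued, so that equating it with a probability includes the claim that it is real.
\<close>

definition coherence_fraction :: "nat \<Rightarrow> complex mat \<Rightarrow> complex" where
  "coherence_fraction n \<rho> = braket (max_coherent n) (\<rho> *\<^sub>v max_coherent n)"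

end

theory Submission
  imports Defs
begin

text \<open>
  Row \<open>z\<close> of the Hadamard transform consists of the entries \<open>(- 1)\<^bsup>z\<cdot>x\<^esup> / \<surd>N\<close>, and the oracle
  multiplies coordinate \<open>x\<close> by the same sign. The signs cancel, so the amplitude of the outcome \<open>z\<close>
  is \<open>(\<Sum>x. \<psi> $ x) / \<surd>N = \<langle>\<eta>|\<psi>\<rangle>\<close>, whatever the state \<open>\<psi>\<close>.
\<close>

text \<open>Among bits, \<open>a * b\<close> is 1 only for the entry in the corner with the minus
  sign. This exponent is the one-qubit case of the dot product.\<close>

lemma hadamard_index:
  assumes "a < 2" "b < 2"
  shows "hadamard $$ (a, b) = complex_of_real (1 / sqrt 2) * (- 1) ^ (a * b)"
  using assms by (auto simp: hadamard_def mat_of_rows_list_def less_2_cases_iff)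

lemma hadamard_dims [simp]: "dim_row hadamard = 2" "dim_col hadamard = 2"
  by (simp_all add: hadamard_def mat_of_rows_list_def)

lemma kron_power_hadamard_dims [simp]:
  "dim_row (kron_power hadamard n) = 2 ^ n" "dim_col (kron_power hadamard n) = 2 ^ n"
  by (induction n) (simp_all add: kron_def)

text \<open>Bit 1 sits at binary position \<open>n\<close>. The bound on \<open>x\<close> makes the
  quotient 0 or 1, so it equals its own parity.\<close>

lemma string_bit_first:
  assumes "x < 2 ^ Suc n"
  shows "string_bit (Suc n) x 1 = x div 2 ^ n"
proof -
  have "x div 2 ^ n < 2"
    using assms by (simp add: less_mult_imp_div_less)
  then show ?thesis
    by (auto simp: string_bit_def bit_iff_odd less_2_cases_iff)
qed

text \<open>Both sides read position \<open>n - k\<close>, which lies below \<open>n\<close> since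
  \<open>k\<close> is at least 1, so the reduction modulo \<open>2 ^ n\<close> keeps it.\<close>

lemma string_bit_Suc:
  assumes "k \<in> {1..n}"
  shows "string_bit (Suc n) x (Suc k) = string_bit n (x mod 2 ^ n) k"
  using assms by (auto simp: string_bit_def simp flip: take_bit_eq_mod simp: bit_take_bit_iff)

text \<open>Quotient and remainder by \<open>2 ^ n\<close> are also how \<open>kron\<close> splits
  an index of \<open>kron_power hadamard (Suc n)\<close>, so the dot product follows the same
  recursion as the matrix.\<close>

lemma string_dot_Suc:
  assumes "x < 2 ^ Suc n" "y < 2 ^ Suc n"
  shows "string_dot (Suc n) x y =
    (x div 2 ^ n) * (y div 2 ^ n) + string_dot n (x mod 2 ^ n) (y mod 2 ^ n)"
proof -
  have "string_dot (Suc n) x y = string_bit (Suc n) x 1 * string_bit (Suc n) y 1 +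
      (\<Sum>k = 1..n. string_bit (Suc n) x (Suc k) * string_bit (Suc n) y (Suc k))"
    unfolding string_dot_def
    \<comment> \<open>\<open>sum.cl_ivl_Suc\<close> would split off the last summand; the leading
      bit is the first one.\<close>
    by (simp add: sum.atLeast_Suc_atMost sum.shift_bounds_cl_Suc_ivl del: sum.cl_ivl_Suc)
  then show ?thesis
    using assms by (simp add: string_bit_first string_bit_Suc string_dot_def del: One_nat_def)
qed

text \<open>Entries of a Kronecker product multiply, so the exponents of the signs add up to the dot
  product and the normalizing factors combine.\<close>

lemma kron_power_hadamard_index:
  assumes "x < 2 ^ n" "y < 2 ^ n"
  shows "kron_power hadamard n $$ (x, y) =
    complex_of_real (1 / sqrt (2 ^ n)) * (- 1) ^ string_dot n x y"
  using assms
proof (induction n arbitrary: x y)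
  case 0
  then show ?case by (simp add: string_dot_def)
next
  case (Suc n)
  have div: "x div 2 ^ n < 2" "y div 2 ^ n < 2"
    using Suc.prems by (simp_all add: less_mult_imp_div_less)
  have "kron_power hadamard (Suc n) $$ (x, y) =
      hadamard $$ (x div 2 ^ n, y div 2 ^ n) *
      kron_power hadamard n $$ (x mod 2 ^ n, y mod 2 ^ n)"
    using Suc.prems by (simp add: kron_def)
  then show ?case
    using Suc.prems div
    by (simp add: Suc.IH hadamard_index string_dot_Suc power_add real_sqrt_mult)
qed

lemma braket_ket:
  assumes "z < 2 ^ n" "dim_vec v = 2 ^ n"
  shows "braket (ket n z) v = v $ z"
proof -
  have "braket (ket n z) v = (\<Sum>i = 0..<2 ^ n. v $ i * cnj (if i = z then 1 else 0))"
    using assms by (simp add: braket_def ket_def scalar_prod_def unit_vec_def)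
  also have "\<dots> = (\<Sum>i = 0..<2 ^ n. if i = z then v $ i else 0)"
    by (rule sum.cong) auto
  finally show ?thesis
    using assms by simp
qed

lemma max_coherent_dim [simp]: "dim_vec (max_coherent n) = 2 ^ n"
proof -
  have "finsum_vec TYPE(complex) (2 ^ n) (ket n) {0..<2 ^ n} \<in> carrier_vec (2 ^ n)"
    by (rule finsum_vec_closed) (auto simp: ket_def)
  then show ?thesis
    by (simp add: max_coherent_def)
qed

lemma max_coherent_index:
  assumes "i < 2 ^ n"
  shows "max_coherent n $ i = complex_of_real (1 / sqrt (2 ^ n))"
proof -
  have closed: "finsum_vec TYPE(complex) (2 ^ n) (ket n) {0..<2 ^ n} \<in> carrier_vec (2 ^ n)"
    by (rule finsum_vec_closed) (auto simp: ket_def)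
  have "finsum_vec TYPE(complex) (2 ^ n) (ket n) {0..<2 ^ n} $ i =
      (\<Sum>x = 0..<2 ^ n. ket n x $ i)"
    using assms by (intro index_finsum_vec) (auto simp: ket_def)
  also have "\<dots> = (\<Sum>x = 0..<2 ^ n. if x = i then 1 else 0)"
    using assms by (intro sum.cong) (auto simp: ket_def)
  also have "\<dots> = 1"
    using assms by simp
  finally show ?thesis
    using assms closed by (simp add: max_coherent_def)
qed

text \<open>The coordinates of \<open>max_coherent n\<close> are real, so the conjugation in
  \<open>braket\<close> disappears.\<close>

lemma braket_max_coherent:
  assumes "dim_vec v = 2 ^ n"
  shows "braket (max_coherent n) v = complex_of_real (1 / sqrt (2 ^ n)) * (\<Sum>i = 0..<2 ^ n. v $ i)"
  using assms
  by (simp add: braket_def scalar_prod_def max_coherent_index sum_distrib_left mult.commute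
      del: of_real_divide)

lemma ketbra_mult_vec:
  assumes "dim_vec w = dim_vec u"
  shows "ketbra v w *\<^sub>v u = braket w u \<cdot>\<^sub>v v"
  using assms
  by (auto simp: ketbra_def braket_def scalar_prod_def sum_distrib_left sum_distrib_right
      intro!: eq_vecI sum.cong)

lemma braket_commute:
  assumes "dim_vec v = dim_vec w"
  shows "braket v w = cnj (braket w v)"
  using assms by (simp add: braket_def scalar_prod_def cnj_sum mult.commute)

text \<open>For a rank-one operator the expectation value factors into an amplitude and its
  conjugate, which also shows that it is real.\<close>

lemma coherence_fraction_ketbra:
  assumes "dim_vec v = 2 ^ n"
  shows "coherence_fraction n (ketbra v v) =
    complex_of_real ((cmod (braket (max_coherent n) v))\<^sup>2)"
proof -
  have "coherence_fraction n (ketbra v v) =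
      braket v (max_coherent n) * braket (max_coherent n) v"
    \<comment> \<open>\<open>braket\<close> is unfolded only after \<open>ketbra_mult_vec\<close>
      has been applied, to pull the scalar out.\<close>
    using assms by (simp add: coherence_fraction_def ketbra_mult_vec)
      (simp add: braket_def)
  then show ?thesis
    using assms braket_commute[of v "max_coherent n"]
    by (simp add: complex_norm_square mult.commute flip: of_real_power)
qed

lemma phase_oracle_mult_vec_index:
  assumes "x < 2 ^ n" "dim_vec v = 2 ^ n"
  shows "(phase_oracle n l *\<^sub>v v) $ x = (- 1) ^ l x * v $ x"
proof -
  have "(phase_oracle n l *\<^sub>v v) $ x =
      (\<Sum>y = 0..<2 ^ n. (if x = y then (- 1) ^ l x else 0) * v $ y)"
    using assms by (simp add: phase_oracle_def scalar_prod_def)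
  also have "\<dots> = (\<Sum>y = 0..<2 ^ n. if x = y then (- 1) ^ l x * v $ y else 0)"
    by (rule sum.cong) auto
  finally show ?thesis
    using assms by simp
qed

lemma braket_ket_gbv_final_state:
  assumes "z < 2 ^ n" "dim_row U = 2 ^ n"
  shows "braket (ket n z) (gbv_final_state n z U) =
    braket (max_coherent n) (gbv_initial_state n U)"
proof -
  define v where "v = gbv_initial_state n U"
  have v: "dim_vec v = 2 ^ n"
    using assms by (simp add: v_def gbv_initial_state_def)
  \<comment> \<open>The two exponents agree only modulo 2, hence the case split on parity.\<close>
  have sign: "(- 1) ^ string_dot n z x * ((- 1) ^ bv_function n z x * c) = c"
    for x and c :: complex
    by (cases "even (string_dot n z x)") (auto simp: bv_function_def odd_iff_mod_2_eq_one)
  have "braket (ket n z) (gbv_final_state n z U) =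
      (kron_power hadamard n *\<^sub>v (phase_oracle n (bv_function n z) *\<^sub>v v)) $ z"
    using assms by (subst braket_ket) (simp_all add: gbv_final_state_def v_def)
  also have "\<dots> = (\<Sum>x = 0..<2 ^ n. kron_power hadamard n $$ (z, x) *
      (phase_oracle n (bv_function n z) *\<^sub>v v) $ x)"
    using assms by (simp add: scalar_prod_def phase_oracle_def)
  also have "\<dots> = (\<Sum>x = 0..<2 ^ n. complex_of_real (1 / sqrt (2 ^ n)) * v $ x)"
    using assms v
    \<comment> \<open>Without \<open>index_mult_mat_vec\<close>, the coordinate of the oracle's
      output stays in the form that \<open>phase_oracle_mult_vec_index\<close> rewrites.\<close>
    by (intro sum.cong)
      (simp_all add: kron_power_hadamard_index phase_oracle_mult_vec_index mult.assoc sign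
        del: of_real_divide index_mult_mat_vec)
  also have "\<dots> = braket (max_coherent n) v"
    using v by (simp add: braket_max_coherent sum_distrib_left)
  finally show ?thesis
    by (simp add: v_def)
qed

theorem theorem1:
  fixes n z :: nat and U \<delta> :: "complex mat" and \<psi> :: "complex vec"
  assumes "n \<ge> 1"
    and "z < 2 ^ n"
    and "U \<in> carrier_mat (2 ^ n) (2 ^ n)"
    and "unitary U"
    and "\<psi> = gbv_initial_state n U"
    and "\<delta> = ketbra \<psi> \<psi>"
  shows "complex_of_real (gbv_success_prob n z U) = coherence_fraction n \<delta>"
  using assms
  by (simp add: gbv_success_prob_def braket_ket_gbv_final_state coherence_fraction_ketbra
      gbv_initial_state_def)

end
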